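(* Let $X\in\mathbb{R}^{n\times n}$ have rank $r$, let $w=(w_1,w_2,w_3)$ have positive entries with $w_4:=w_2w_3/w_1$, and let $h_w$, $B_L,B_R,O_L,O_R$ be as in the context. Let $\widehat T:=\mathrm{supp}(h_w(X))$ and $T_1:=\mathrm{supp}(I_r)$, where $I_r$ is regarded as the $n\times n$ matrix $\begin{bmatrix}I_r&0\\0&0\end{bmatrix}$. Then $$\mathrm{sgn}(h_w(X))=B_LO_L\,\mathcal P_{T_1}(I_n)\,O_R^\top B_R^\top,$$ and for every $Z\in\mathbb{R}^{n\times n}$, $$\mathcal P_{\widehat T^\perp}(Z)=B_LO_L\,\mathcal P_{T_1^\perp}\big(O_L^\top B_L^\top ZB_RO_R\big)\,O_R^\top B_R^\top .$$
   Context: All matrices are real. For a matrix $Y\in\mathbb{R}^{n\times n}$ of rank $k$ with reduced SVD $Y=U_Y\Sigma_YV_Y^\top$: $\mathrm{sgn}(Y)=U_YV_Y^\top$; with $P=U_YU_Y^\top$, $Q=V_YV_Y^\top$, $\mathrm{supp}(Y)=\{Z: Z=PZQ+PZ(I-Q)+(I-P)ZQ\}$; $\mathcal P_T$ and $\mathcal P_{T^\perp}$ denote orthogonal projections (Frobenius inner product) onto $T$ and $T^\perp$, so for $T=\mathrm{supp}(Y)$, $\mathcal P_{T^\perp}(Z)=(I-P)Z(I-Q)$. Thus $T_1$ is the space of matrices whose lower-right $(n-r)\times(n-r)$ block is zero. Setting: $X=U\Sigma V^\top$ is a reduced SVD with $U,V\in\mathbb{R}^{n\times r}$; $\widetilde{\mathcal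 U},\widetilde{\mathcal V}\subseteq\mathbb{R}^n$ are subspaces of dimension $r'$, $r\le r'\le n-r$, with principal angles $\theta_u(1)\ge\dots\ge\theta_u(r)$ to $\mathcal U=\mathrm{range}(U)$ and $\theta_v(1)\ge\dots\ge\theta_v(r)$ to $\mathcal V=\mathrm{range}(V)$. $\cos(\boldsymbol\theta)=\mathrm{diag}(\cos\theta(r),\dots,\cos\theta(1))$, $\sin(\boldsymbol\theta)=\mathrm{diag}(\sin\theta(r),\dots,\sin\theta(1))$. $B_L,B_R\in\mathbb{R}^{n\times n}$ are orthogonal matrices whose first $r$ columns are $U$ and $V$ respectively, and such that $$\widetilde U=B_L\begin{bmatrix}\cos(\boldsymbol\theta_u)&0\\-\sin(\boldsymbol\theta_u)&0\\0&-I_{r'-r}\\0&0\end{bmatrix},\qquad \widetilde V=B_R\begin{bmatrix}\cos(\boldsymbol\theta_v)&0\\-\sin(\boldsymbol\theta_v)&0\\0&-I_{r'-r}\\0&0\end{bmatrix}$$ (row blocks of sizes $r,r,r'-r,n-r-r'$) are orthonormal bases of $\widetilde{\mathcal U}$ and $\widetilde{\mathcal V}$ (the paper takes the bases $U,V$ of the SVD to be the principal-vector bases). $h_w(Z)=w_1P_{\widetilde{\mathcal U}}ZP_{\widetilde{\mathcal V}}+w_2P_{\widetilde{\mathcal U}}ZP_{\widetilde{\mathcal V}^\perp}+w_3P_{\widetilde{\mathcal U}^\perp}ZP_{\widetilde{\mathcal V}}+w_4P_{\widetilde{\mathcal U}^\perp}ZP_{\widetilde{\mathcal V}^\perp}$,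 with $P_{\mathcal S}$ the orthogonal projection onto $\mathcal S$. With $C_L=(w_1^2\cos^2(\boldsymbol\theta_u)+w_3^2\sin^2(\boldsymbol\theta_u))^{1/2}$, $C_R=(w_3^2\cos^2(\boldsymbol\theta_v)+w_4^2\sin^2(\boldsymbol\theta_v))^{1/2}$, the matrices $O_L,O_R$ are block diagonal, $O_L=\mathrm{diag}(O_L',I_{r'-r},I_{n-r-r'})$, $O_R=\mathrm{diag}(O_R',I_{r'-r},I_{n-r-r'})$, with $$O_L'=\begin{bmatrix}(w_1\cos^2(\boldsymbol\theta_u)+w_3\sin^2(\boldsymbol\theta_u))C_L^{-1}&(w_1-w_3)\sin(\boldsymbol\theta_u)\cos(\boldsymbol\theta_u)C_L^{-1}\\(w_3-w_1)\sin(\boldsymbol\theta_u)\cos(\boldsymbol\theta_u)C_L^{-1}&(w_1\cos^2(\boldsymbol\theta_u)+w_3\sin^2(\boldsymbol\theta_u))C_L^{-1}\end{bmatrix},$$ $$O_R'=\begin{bmatrix}(w_3\cos^2(\boldsymbol\theta_v)+w_4\sin^2(\boldsymbol\theta_v))C_R^{-1}&(w_3-w_4)\sin(\boldsymbol\theta_v)\cos(\boldsymbol\theta_v)C_R^{-1}\\(w_4-w_3)\sin(\boldsymbol\theta_v)\cos(\boldsymbol\theta_v)C_R^{-1}&(w_3\cos^2(\boldsymbol\theta_v)+w_4\sin^2(\boldsymbol\theta_v))C_R^{-1}\end{bmatrix}.$$ *)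

theory Defs
  imports Complex_Main "Jordan_Normal_Form.DL_Rank"
begin

section \<open>Reduced SVD, matrix sign and support\<close>

text \<open>The singular values need not be sorted, and \<open>k = 0\<close> is allowed (the zero matrix). Since
  they are positive, \<open>k\<close> is the rank of \<open>Y\<close>.\<close>

definition reduced_svd ::
    "real mat \<Rightarrow> nat \<Rightarrow> real mat \<Rightarrow> real mat \<Rightarrow> real mat \<Rightarrow> bool" where
  "reduced_svd Y k U S V \<longleftrightarrow>
     U \<in> carrier_mat (dim_row Y) k \<and> V \<in> carrier_mat (dim_col Y) k \<and> S \<in> carrier_mat k k \<and>
     U\<^sup>T * U = 1\<^sub>m k \<and> V\<^sup>T * V = 1\<^sub>m k \<and>
     diagonal_mat S \<and> (\<forall>i<k. S $$ (i,i) > 0) \<and>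
     Y = U * S * V\<^sup>T"

text \<open>A choice of singular vector bases. The products \<open>U V\<^sup>T\<close>, \<open>U U\<^sup>T\<close> and \<open>V V\<^sup>T\<close> used below
  depend only on \<open>Y\<close>, not on the decomposition that is chosen.\<close>

definition svd_bases :: "real mat \<Rightarrow> real mat \<times> real mat" where
  "svd_bases Y = (SOME UV. \<exists>k S. reduced_svd Y k (fst UV) S (snd UV))"

definition sgn_mat :: "real mat \<Rightarrow> real mat" where
  "sgn_mat Y = fst (svd_bases Y) * (snd (svd_bases Y))\<^sup>T"

definition supp :: "nat \<Rightarrow> real mat \<Rightarrow> real mat set" where
  "supp n Y =
     (let P = fst (svd_bases Y) * (fst (svd_bases Y))\<^sup>T;
          Q = snd (svd_bases Y) * (snd (svd_bases Y))\<^sup>T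
      in {Z \<in> carrier_mat n n.
            Z = P * Z * Q + P * Z * (1\<^sub>m n - Q) + (1\<^sub>m n - P) * Z * Q})"


section \<open>Orthogonal projections\<close>

definition frob_inner :: "nat \<Rightarrow> real mat \<Rightarrow> real mat \<Rightarrow> real" where
  "frob_inner n A B = (\<Sum>i<n. \<Sum>j<n. A $$ (i,j) * B $$ (i,j))"

definition frob_compl :: "nat \<Rightarrow> real mat set \<Rightarrow> real mat set" where
  "frob_compl n T = {Z \<in> carrier_mat n n. \<forall>W\<in>T. frob_inner n Z W = 0}"

text \<open>Meaningful when \<open>T\<close> is a linear subspace of the \<open>n \<times> n\<close> matrices and \<open>Z\<close> is \<open>n \<times> n\<close>.\<close>

definition frob_proj :: "nat \<Rightarrow> real mat set \<Rightarrow> real mat \<Rightarrow> real mat" where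
  "frob_proj n T Z = (THE W. W \<in> T \<and> Z - W \<in> frob_compl n T)"

definition vec_compl :: "nat \<Rightarrow> real vec set \<Rightarrow> real vec set" where
  "vec_compl n S = {x \<in> carrier_vec n. \<forall>y\<in>S. x \<bullet> y = 0}"

text \<open>The matrix of the orthogonal projection of \<open>\<real>\<^sup>n\<close> onto the linear subspace \<open>S\<close>.\<close>

definition proj_mat :: "nat \<Rightarrow> real vec set \<Rightarrow> real mat" where
  "proj_mat n S = (THE P. P \<in> carrier_mat n n \<and>
     (\<forall>x\<in>carrier_vec n. P *\<^sub>v x \<in> S \<and> x - P *\<^sub>v x \<in> vec_compl n S))"

definition h_w :: "nat \<Rightarrow> real \<Rightarrow> real \<Rightarrow> real \<Rightarrow> real \<Rightarrow> real vec set \<Rightarrow> real vec set \<Rightarrow>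
    real mat \<Rightarrow> real mat" where
  "h_w n w1 w2 w3 w4 Us Vs Z =
     w1 \<cdot>\<^sub>m (proj_mat n Us * Z * proj_mat n Vs)
   + w2 \<cdot>\<^sub>m (proj_mat n Us * Z * proj_mat n (vec_compl n Vs))
   + w3 \<cdot>\<^sub>m (proj_mat n (vec_compl n Us) * Z * proj_mat n Vs)
   + w4 \<cdot>\<^sub>m (proj_mat n (vec_compl n Us) * Z * proj_mat n (vec_compl n Vs))"


section \<open>Subspaces and principal angles\<close>

definition subspace_of_dim :: "nat \<Rightarrow> nat \<Rightarrow> real vec set \<Rightarrow> bool" where
  "subspace_of_dim n k S \<longleftrightarrow>
     VectorSpace.subspace class_ring S (module_vec TYPE(real) n) \<and>
     vectorspace.dim class_ring (module_vec TYPE(real) n\<lparr>carrier := S\<rparr>) = k"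

definition orthonormal_basis :: "nat \<Rightarrow> nat \<Rightarrow> real mat \<Rightarrow> real vec set \<Rightarrow> bool" where
  "orthonormal_basis n k W S \<longleftrightarrow>
     W \<in> carrier_mat n k \<and> W\<^sup>T * W = 1\<^sub>m k \<and> vec_space.col_space n W = S"

text \<open>The usual recursive definition by successive maximisation of \<open>x \<bullet> y\<close> over unit vectors
  orthogonal to the principal vectors found so far. The angles are numbered in nonincreasing order
  \<open>\<theta> 1 \<ge> \<dots> \<ge> \<theta> r\<close>, so the recursion starts at \<open>k = r\<close> (the smallest angle) and runs down to
  \<open>k = 1\<close>. Values of \<open>\<theta>\<close> outside \<open>{1..r}\<close> are irrelevant.\<close>

definition principal_angles ::
    "nat \<Rightarrow> real vec set \<Rightarrow> real vec set \<Rightarrow> (nat \<Rightarrow> real) \<Rightarrow> bool" where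
  "principal_angles r S T \<theta> \<longleftrightarrow>
     (\<exists>p q. \<forall>k\<in>{1..r}.
        p k \<in> S \<and> q k \<in> T \<and> p k \<bullet> p k = 1 \<and> q k \<bullet> q k = 1 \<and>
        (\<forall>j\<in>{k<..r}. p k \<bullet> p j = 0 \<and> q k \<bullet> q j = 0) \<and>
        (\<forall>x\<in>S. \<forall>y\<in>T. x \<bullet> x = 1 \<and> y \<bullet> y = 1 \<and>
            (\<forall>j\<in>{k<..r}. x \<bullet> p j = 0 \<and> y \<bullet> q j = 0) \<longrightarrow> x \<bullet> y \<le> p k \<bullet> q k) \<and>
        0 \<le> \<theta> k \<and> \<theta> k \<le> pi / 2 \<and> cos (\<theta> k) = p k \<bullet> q k)"


section \<open>Block matrices\<close>

text \<open>Diagonal matrices list the angles in the order \<open>\<theta> r, \<dots>, \<theta> 1\<close>, and indices of matrix entries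
  start at 0; so the \<open>i\<close>-th diagonal entry involves \<open>\<theta> (r - i)\<close>.\<close>

definition cos_mat :: "nat \<Rightarrow> (nat \<Rightarrow> real) \<Rightarrow> real mat" where
  "cos_mat r \<theta> = mat_diag r (\<lambda>i. cos (\<theta> (r - i)))"

definition sin_mat :: "nat \<Rightarrow> (nat \<Rightarrow> real) \<Rightarrow> real mat" where
  "sin_mat r \<theta> = mat_diag r (\<lambda>i. sin (\<theta> (r - i)))"

text \<open>The \<open>n \<times> r'\<close> matrix with row blocks \<open>[cos \<theta>, 0]\<close>, \<open>[-sin \<theta>, 0]\<close>, \<open>[0, -I]\<close>, \<open>[0, 0]\<close> of
  heights \<open>r\<close>, \<open>r\<close>, \<open>r' - r\<close>, \<open>n - r - r'\<close>.\<close>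

definition angle_block :: "nat \<Rightarrow> nat \<Rightarrow> nat \<Rightarrow> (nat \<Rightarrow> real) \<Rightarrow> real mat" where
  "angle_block n r r' \<theta> =
     four_block_mat
       (cos_mat r \<theta> @\<^sub>r (- sin_mat r \<theta>))   (0\<^sub>m (r + r) (r' - r))
       (0\<^sub>m ((r' - r) + (n - r - r')) r)   ((- 1\<^sub>m (r' - r)) @\<^sub>r 0\<^sub>m (n - r - r') (r' - r))"

text \<open>\<open>O_mat\<close> with weights \<open>(w\<^sub>1, w\<^sub>3)\<close> and angles \<open>\<theta>\<^sub>u\<close> is \<open>O\<^sub>L\<close>; with weights \<open>(w\<^sub>3, w\<^sub>4)\<close> and
  angles \<open>\<theta>\<^sub>v\<close> it is \<open>O\<^sub>R\<close>. All blocks of \<open>O_block\<close> are diagonal, so their products, inverses and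
  square roots are taken entrywise.\<close>

definition O_block :: "nat \<Rightarrow> real \<Rightarrow> real \<Rightarrow> (nat \<Rightarrow> real) \<Rightarrow> real mat" where
  "O_block r a b \<theta> =
     (let c = (\<lambda>i. cos (\<theta> (r - i)));
          s = (\<lambda>i. sin (\<theta> (r - i)));
          C = (\<lambda>i. sqrt (a\<^sup>2 * (c i)\<^sup>2 + b\<^sup>2 * (s i)\<^sup>2))
      in four_block_mat
           (mat_diag r (\<lambda>i. (a * (c i)\<^sup>2 + b * (s i)\<^sup>2) / C i))
           (mat_diag r (\<lambda>i. (a - b) * s i * c i / C i))
           (mat_diag r (\<lambda>i. (b - a) * s i * c i / C i))
           (mat_diag r (\<lambda>i. (a * (c i)\<^sup>2 + b * (s i)\<^sup>2) / C i)))"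

definition O_mat :: "nat \<Rightarrow> nat \<Rightarrow> nat \<Rightarrow> real \<Rightarrow> real \<Rightarrow> (nat \<Rightarrow> real) \<Rightarrow> real mat" where
  "O_mat n r r' a b \<theta> = diag_block_mat [O_block r a b \<theta>, 1\<^sub>m (r' - r), 1\<^sub>m (n - r - r')]"

definition padded_id :: "nat \<Rightarrow> nat \<Rightarrow> real mat" where
  "padded_id n r =
     four_block_mat (1\<^sub>m r) (0\<^sub>m r (n - r)) (0\<^sub>m (n - r) r) (0\<^sub>m (n - r) (n - r))"

end

theory Submission
  imports Defs
begin

text \<open>Because \<open>w\<^sub>4 = w\<^sub>2 w\<^sub>3 / w\<^sub>1\<close>, the operator factors as \<open>h\<^sub>w(X) = w\<^sub>3\<^sup>-\<^sup>1 L X R\<close> with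
  \<open>L = w\<^sub>1 P + w\<^sub>3 (I - P)\<close> and \<open>R = w\<^sub>3 Q + w\<^sub>4 (I - Q)\<close>, where \<open>P\<close>, \<open>Q\<close> project onto the two
  given subspaces. Writing \<open>E\<close> for the first \<open>r\<close> columns of the identity, one has
  \<open>L U = B\<^sub>L O\<^sub>L E C\<^sub>L\<close> and \<open>R V = B\<^sub>R O\<^sub>R E C\<^sub>R\<close> with positive diagonal \<open>C\<^sub>L\<close>, \<open>C\<^sub>R\<close>. Hence
  \<open>h\<^sub>w(X) = (B\<^sub>L O\<^sub>L E) (w\<^sub>3\<^sup>-\<^sup>1 C\<^sub>L \<Sigma> C\<^sub>R) (B\<^sub>R O\<^sub>R E)\<^sup>T\<close> is itself a reduced SVD, and the sign and
  the support do not depend on the decomposition used to compute them.\<close>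

section \<open>Matrix algebra\<close>

declare minus_carrier_mat [simp]

lemma square_mult_carrier [simp, intro]:
  "A \<in> carrier_mat n n \<Longrightarrow> B \<in> carrier_mat n n \<Longrightarrow> A * B \<in> carrier_mat n n"
  by (rule mult_carrier_mat)

text \<open>Conditions on dimensions, unlike carrier conditions, mention only variables of the
  rewritten term, so the simplifier can discharge them while it nests products to the right.\<close>

lemma mult_mat_assoc_dim:
  "dim_col A = dim_row B \<Longrightarrow> dim_col B = dim_row C \<Longrightarrow> (A * B) * C = A * (B * C)"
  for A B C :: "'a::semiring_0 mat"
  by (rule assoc_mult_mat[of A "dim_row A" "dim_col A" B "dim_col B" C "dim_col C"]) auto

lemma transpose_mult_dim:
  "dim_col A = dim_row B \<Longrightarrow> (A * B)\<^sup>T = B\<^sup>T * A\<^sup>T"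
  for A B :: "'a::comm_semiring_0 mat"
  by (rule transpose_mult[of A "dim_row A" "dim_col A" B "dim_col B"]) auto

text \<open>In a right-nested product \<open>A\<close> and \<open>B\<close> are separated by a
  parenthesis; this form lets an identity such as \<open>U\<^sup>T * U = 1\<^sub>m k\<close> still
  cancel there.\<close>

lemma mult_mat_cancel:
  fixes A B C :: "'a::semiring_1 mat"
  assumes "A * B = 1\<^sub>m k" "dim_col A = dim_row B" "dim_row C = k"
  shows "A * (B * C) = C"
proof -
  have "dim_col B = k" using arg_cong[OF assms(1), of dim_col] by simp
  then have "A * (B * C) = 1\<^sub>m k * C"
    using assms(2,3) by (subst assms(1)[symmetric], intro mult_mat_assoc_dim[symmetric]) auto
  also have "\<dots> = C" using assms(3) by (intro left_mult_one_mat[of C k "dim_col C"]) auto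
  finally show ?thesis .
qed

lemma mat_diag_transpose [simp]: "(mat_diag k f)\<^sup>T = mat_diag k f"
  by (rule eq_matI) (auto simp: mat_diag_def)

lemma mat_diag_dims [simp]: "dim_row (mat_diag k f) = k" "dim_col (mat_diag k f) = k"
  by (simp_all add: mat_diag_def)

lemma mat_diag_right_cancel:
  fixes A B :: "'a::field mat"
  assumes "A * mat_diag k f = B * mat_diag k f" "A \<in> carrier_mat m k" "B \<in> carrier_mat m k"
    "\<And>i. i < k \<Longrightarrow> f i \<noteq> 0"
  shows "A = B"
proof (rule eq_matI)
  fix i j assume "i < dim_row B" "j < dim_col B"
  then have "i < m" "j < k" using assms by auto
  moreover have "(A * mat_diag k f) $$ (i,j) = (B * mat_diag k f) $$ (i,j)" using assms by simp
  ultimately show "A $$ (i,j) = B $$ (i,j)"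
    using assms(4)[of j] by (simp add: mat_diag_mult_right[OF assms(2)] mat_diag_mult_right[OF assms(3)])
qed (use assms in auto)

lemma smult_mat_diag: "c \<cdot>\<^sub>m mat_diag k f = mat_diag k (\<lambda>i. c * f i)"
  for c :: "'a::mult_zero"
  by (rule eq_matI) (auto simp: mat_diag_def)

lemma orthogonal_mat_inv:
  fixes M :: "real mat"
  assumes "M \<in> carrier_mat n n" "M\<^sup>T * M = 1\<^sub>m n"
  shows "M * M\<^sup>T = 1\<^sub>m n"
  by (rule mat_mult_left_right_inverse[of "M\<^sup>T" n]) (use assms in auto)

section \<open>Uniqueness of the reduced SVD\<close>

lemma reduced_svdD:
  assumes "reduced_svd Y k U S V"
  shows "dim_row U = dim_row Y" "dim_col U = k" "dim_row V = dim_col Y" "dim_col V = k"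
    "U\<^sup>T * U = 1\<^sub>m k" "V\<^sup>T * V = 1\<^sub>m k" "\<And>i. i < k \<Longrightarrow> S $$ (i,i) > 0" "Y = U * S * V\<^sup>T"
  using assms unfolding reduced_svd_def carrier_mat_def by blast+

lemma reduced_svd_diag:
  assumes "reduced_svd Y k U S V"
  shows "S = mat_diag k (\<lambda>i. S $$ (i,i))"
  using assms by (intro eq_matI) (auto simp: reduced_svd_def mat_diag_def diagonal_mat_def)

text \<open>For two decompositions \<open>U S V\<^sup>T = U' S' V'\<^sup>T\<close>, the overlaps \<open>M = U\<^sup>T U'\<close> and \<open>N = V\<^sup>T V'\<close>
  satisfy \<open>S N = M S'\<close> and \<open>S M = N S'\<close>. Entrywise \<open>s (N - M) = - s' (N - M)\<close>, so positivity of
  the singular values forces \<open>M = N\<close>.\<close>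

lemma reduced_svd_overlap:
  assumes 1: "reduced_svd Y k U S V" and 2: "reduced_svd Y l U' S' V'"
  shows "U * (U\<^sup>T * U') = U'" "V * (U\<^sup>T * U') = V'"
proof -
  note [simp] = reduced_svdD(1-4)[OF 1] reduced_svdD(1-4)[OF 2]
  note orth = reduced_svdD(5,6)[OF 1] reduced_svdD(5,6)[OF 2]
  define s where "s i = S $$ (i,i)" for i
  define s' where "s' i = S' $$ (i,i)" for i
  have S: "S = mat_diag k s" and S': "S' = mat_diag l s'"
    unfolding s_def s'_def by (fact reduced_svd_diag[OF 1], fact reduced_svd_diag[OF 2])
  have pos: "\<And>i. i < k \<Longrightarrow> s i > 0" "\<And>i. i < l \<Longrightarrow> s' i > 0"
    using reduced_svdD(7)[OF 1] reduced_svdD(7)[OF 2] by (auto simp: s_def s'_def)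
  have Y: "Y = U * (mat_diag k s * V\<^sup>T)" "Y = U' * (mat_diag l s' * V'\<^sup>T)"
    using reduced_svdD(8)[OF 1] reduced_svdD(8)[OF 2]
    unfolding S S' by (simp_all add: mult_mat_assoc_dim)
  define M where "M = U\<^sup>T * U'"
  define N where "N = V\<^sup>T * V'"
  have car: "M \<in> carrier_mat k l" "N \<in> carrier_mat k l" by (auto simp: M_def N_def)
  \<comment> \<open>\<open>Y * V'\<close> is evaluated through both decompositions; in the second
    one \<open>V'\<close> cancels by orthonormality.\<close>
  have YV: "U * (mat_diag k s * N) = U' * mat_diag l s'"
  proof -
    have "U * (mat_diag k s * N) = Y * V'" by (subst Y(1)) (simp add: N_def mult_mat_assoc_dim)
    also have "\<dots> = U' * mat_diag l s'"
      by (subst Y(2)) (simp add: mult_mat_assoc_dim orth right_mult_one_mat[of _ l l])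
    finally show ?thesis .
  qed
  have YU: "V * (mat_diag k s * M) = V' * mat_diag l s'"
  proof -
    have "V * (mat_diag k s * M) = Y\<^sup>T * U'"
      by (subst Y(1)) (simp add: M_def mult_mat_assoc_dim transpose_mult_dim)
    also have "\<dots> = V' * mat_diag l s'"
      by (subst Y(2)) (simp add: mult_mat_assoc_dim transpose_mult_dim orth right_mult_one_mat[of _ l l])
    finally show ?thesis .
  qed
  have SN: "mat_diag k s * N = M * mat_diag l s'"
    using arg_cong[OF YV, of "\<lambda>A. U\<^sup>T * A"] car
    by (simp add: M_def mult_mat_cancel[OF orth(1)] mult_mat_assoc_dim)
  have SM: "mat_diag k s * M = N * mat_diag l s'"
    using arg_cong[OF YU, of "\<lambda>A. V\<^sup>T * A"] car
    by (simp add: N_def mult_mat_cancel[OF orth(2)] mult_mat_assoc_dim)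
  have MN: "N = M"
  proof (rule eq_matI)
    fix i j assume "i < dim_row M" "j < dim_col M"
    then have ij: "i < k" "j < l" using car by auto
    have "s i * N $$ (i,j) = M $$ (i,j) * s' j"
      using arg_cong[OF SN, of "\<lambda>A. A $$ (i,j)"] ij car
      by (simp add: mat_diag_mult_left[of _ k l] mat_diag_mult_right[of _ k l])
    moreover have "s i * M $$ (i,j) = N $$ (i,j) * s' j"
      using arg_cong[OF SM, of "\<lambda>A. A $$ (i,j)"] ij car
      by (simp add: mat_diag_mult_left[of _ k l] mat_diag_mult_right[of _ k l])
    ultimately have "(s i + s' j) * (N $$ (i,j) - M $$ (i,j)) = 0" by (simp add: algebra_simps)
    moreover have "s i + s' j > 0" using pos ij by (simp add: add_pos_pos)
    ultimately show "N $$ (i,j) = M $$ (i,j)" by simp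
  qed (use car in auto)
  \<comment> \<open>\<open>M * mat_diag l s'\<close> equals \<open>mat_diag k s * N\<close>, so both
    sides are \<open>Y * V'\<close>; the diagonal factor has nonzero entries and can be cancelled on
    the right.\<close>
  have "(U * M) * mat_diag l s' = U' * mat_diag l s'"
    using car by (simp add: mult_mat_assoc_dim SN[symmetric] YV)
  moreover have "U * M \<in> carrier_mat (dim_row Y) l" "U' \<in> carrier_mat (dim_row Y) l"
    using car by auto
  ultimately have "U * M = U'" using pos(2) by (metis mat_diag_right_cancel less_irrefl)
  then show "U * (U\<^sup>T * U') = U'" by (simp only: M_def)
  have "(V * M) * mat_diag l s' = V' * mat_diag l s'"
    using car by (simp add: mult_mat_assoc_dim SM[unfolded MN, symmetric] YU)
  moreover have "V * M \<in> carrier_mat (dim_col Y) l" "V' \<in> carrier_mat (dim_col Y) l"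
    using car by auto
  ultimately have "V * M = V'" using pos(2) by (metis mat_diag_right_cancel less_irrefl)
  then show "V * (U\<^sup>T * U') = V'" by (simp only: M_def)
qed

text \<open>Overlaps in both directions give \<open>U' * U'\<^sup>T * U = U\<close> and
  \<open>V'\<^sup>T = U'\<^sup>T * U * V\<^sup>T\<close>. Substituting the second into
  \<open>U' * V'\<^sup>T\<close> and applying the first leaves \<open>U * V\<^sup>T\<close>; the
  other two products are treated alike.\<close>

lemma reduced_svd_unique:
  assumes 1: "reduced_svd Y k U S V" and 2: "reduced_svd Y l U' S' V'"
  shows "U' * V'\<^sup>T = U * V\<^sup>T" "U' * U'\<^sup>T = U * U\<^sup>T" "V' * V'\<^sup>T = V * V\<^sup>T"
proof -
  note [simp] = reduced_svdD(1-4)[OF 1] reduced_svdD(1-4)[OF 2]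
  note o12 = reduced_svd_overlap[OF 1 2] and o21 = reduced_svd_overlap[OF 2 1]
  have a: "U' * U'\<^sup>T * U = U" "V' * U'\<^sup>T * U = V"
    using o21 by (simp_all add: mult_mat_assoc_dim)
  have V't: "V'\<^sup>T = U'\<^sup>T * U * V\<^sup>T" and U't: "U'\<^sup>T = U'\<^sup>T * U * U\<^sup>T"
    using arg_cong[OF o12(1), of transpose_mat] arg_cong[OF o12(2), of transpose_mat]
    by (simp_all add: transpose_mult_dim)
  have "U' * V'\<^sup>T = (U' * U'\<^sup>T * U) * V\<^sup>T" by (subst V't) (simp add: mult_mat_assoc_dim)
  then show "U' * V'\<^sup>T = U * V\<^sup>T" by (simp add: a)
  have "U' * U'\<^sup>T = (U' * U'\<^sup>T * U) * U\<^sup>T" by (subst U't) (simp add: mult_mat_assoc_dim)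
  then show "U' * U'\<^sup>T = U * U\<^sup>T" by (simp add: a)
  have "V' * V'\<^sup>T = (V' * U'\<^sup>T * U) * V\<^sup>T" by (subst V't) (simp add: mult_mat_assoc_dim)
  then show "V' * V'\<^sup>T = V * V\<^sup>T" by (simp add: a)
qed

text \<open>The given decomposition witnesses that the choice in \<open>svd_bases\<close> succeeds;
  uniqueness then carries the three products from the chosen bases to any convenient ones.\<close>

lemma svd_bases_unique:
  assumes "reduced_svd Y k U S V"
  defines "U' \<equiv> fst (svd_bases Y)" and "V' \<equiv> snd (svd_bases Y)"
  shows "U' * V'\<^sup>T = U * V\<^sup>T" "U' * U'\<^sup>T = U * U\<^sup>T" "V' * V'\<^sup>T = V * V\<^sup>T"
proof -
  have "\<exists>k S. reduced_svd Y k U' S V'"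
    unfolding U'_def V'_def svd_bases_def
    by (rule someI[of "\<lambda>UV. \<exists>k S. reduced_svd Y k (fst UV) S (snd UV)" "(U, V)"]) (use assms in auto)
  then show "U' * V'\<^sup>T = U * V\<^sup>T" "U' * U'\<^sup>T = U * U\<^sup>T" "V' * V'\<^sup>T = V * V\<^sup>T"
    using reduced_svd_unique[OF assms(1)] by blast+
qed

lemma sgn_mat_eq: "reduced_svd Y k U S V \<Longrightarrow> sgn_mat Y = U * V\<^sup>T"
  by (simp add: sgn_mat_def svd_bases_unique)

section \<open>Projections onto a support and its complement\<close>

lemma frob_inner_adjoint_left:
  assumes "A \<in> carrier_mat n n" "B \<in> carrier_mat n n" "C \<in> carrier_mat n n"
  shows "frob_inner n (A * B) C = frob_inner n B (A\<^sup>T * C)"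
proof -
  have "frob_inner n (A * B) C = (\<Sum>i<n. \<Sum>j<n. \<Sum>k<n. A $$ (i,k) * B $$ (k,j) * C $$ (i,j))"
    using assms by (simp add: frob_inner_def scalar_prod_def sum_distrib_right lessThan_atLeast0)
  \<comment> \<open>Three exchanges move the row index \<open>i\<close> innermost, where the sum
    over \<open>i\<close> forms an entry of \<open>A\<^sup>T * C\<close>.\<close>
  also have "\<dots> = (\<Sum>i<n. \<Sum>k<n. \<Sum>j<n. A $$ (i,k) * B $$ (k,j) * C $$ (i,j))"
    by (intro sum.cong refl sum.swap)
  also have "\<dots> = (\<Sum>k<n. \<Sum>i<n. \<Sum>j<n. A $$ (i,k) * B $$ (k,j) * C $$ (i,j))" by (rule sum.swap)
  also have "\<dots> = (\<Sum>k<n. \<Sum>j<n. \<Sum>i<n. A $$ (i,k) * B $$ (k,j) * C $$ (i,j))"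
    by (intro sum.cong refl sum.swap)
  also have "\<dots> = frob_inner n B (A\<^sup>T * C)"
    using assms
    by (simp add: frob_inner_def scalar_prod_def sum_distrib_left lessThan_atLeast0 mult_ac)
  finally show ?thesis .
qed

lemma frob_inner_transpose:
  "A \<in> carrier_mat n n \<Longrightarrow> B \<in> carrier_mat n n \<Longrightarrow> frob_inner n A\<^sup>T B\<^sup>T = frob_inner n A B"
  unfolding frob_inner_def by (subst sum.swap) simp

text \<open>Transposition preserves the inner product and turns right multiplication into left
  multiplication.\<close>

lemma frob_inner_adjoint_right:
  assumes "A \<in> carrier_mat n n" "B \<in> carrier_mat n n" "C \<in> carrier_mat n n"
  shows "frob_inner n (A * B) C = frob_inner n A (C * B\<^sup>T)"
proof -
  have "frob_inner n (A * B) C = frob_inner n (B\<^sup>T * A\<^sup>T) C\<^sup>T"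
    using assms by (metis frob_inner_transpose mult_carrier_mat transpose_mult)
  also have "\<dots> = frob_inner n A\<^sup>T (B * C\<^sup>T)"
    using assms by (simp add: frob_inner_adjoint_left)
  also have "\<dots> = frob_inner n A\<^sup>T (C * B\<^sup>T)\<^sup>T"
    using assms by (simp add: transpose_mult_dim)
  also have "\<dots> = frob_inner n A (C * B\<^sup>T)"
    using assms by (intro frob_inner_transpose) auto
  finally show ?thesis .
qed

lemma frob_inner_comm: "frob_inner n A B = frob_inner n B A"
  by (simp add: frob_inner_def mult.commute)

lemma frob_inner_diff_left:
  "A \<in> carrier_mat n n \<Longrightarrow> B \<in> carrier_mat n n \<Longrightarrow>
    frob_inner n (A - B) C = frob_inner n A C - frob_inner n B C"
  by (simp add: frob_inner_def sum_subtractf algebra_simps)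

lemma frob_inner_self_eq_0:
  assumes "A \<in> carrier_mat n n" "frob_inner n A A = 0"
  shows "A = 0\<^sub>m n n"
proof (rule eq_matI)
  fix i j assume "i < dim_row (0\<^sub>m n n :: real mat)" "j < dim_col (0\<^sub>m n n :: real mat)"
  then have ij: "i < n" "j < n" by auto
  have "\<forall>i<n. (\<Sum>j<n. A $$ (i,j) * A $$ (i,j)) = 0"
    using assms(2) unfolding frob_inner_def
    by (subst (asm) sum_nonneg_eq_0_iff) (auto intro!: sum_nonneg)
  then have "(\<Sum>j<n. A $$ (i,j) * A $$ (i,j)) = 0" using ij by blast
  then have "A $$ (i,j) * A $$ (i,j) = 0"
    using ij by (subst (asm) sum_nonneg_eq_0_iff) auto
  then show "A $$ (i,j) = 0\<^sub>m n n $$ (i,j)" using ij by simp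
qed (use assms in auto)

section \<open>Frobenius complements and the projections onto them\<close>

lemma frob_compl_subset: "frob_compl n T \<subseteq> carrier_mat n n"
  by (auto simp: frob_compl_def)

lemma frob_compl_minus:
  "A \<in> frob_compl n T \<Longrightarrow> B \<in> frob_compl n T \<Longrightarrow> A - B \<in> frob_compl n T"
  by (auto simp: frob_compl_def frob_inner_diff_left)

text \<open>Two candidates differ by a matrix lying both in \<open>T\<close> and in its complement,
  hence orthogonal to itself and zero. So the definite description in \<open>frob_proj\<close>
  denotes \<open>W\<close>.\<close>

lemma frob_proj_eqI:
  assumes "T \<subseteq> carrier_mat n n" "\<And>A B. A \<in> T \<Longrightarrow> B \<in> T \<Longrightarrow> A - B \<in> T"
    "Z \<in> carrier_mat n n" "W \<in> T" "Z - W \<in> frob_compl n T"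
  shows "frob_proj n T Z = W"
  unfolding frob_proj_def
proof (rule the_equality)
  fix W' assume W': "W' \<in> T \<and> Z - W' \<in> frob_compl n T"
  have c: "W \<in> carrier_mat n n" "W' \<in> carrier_mat n n" using assms W' by auto
  have "(Z - W) - (Z - W') = W' - W" using c assms(3) by (intro eq_matI) auto
  then have "W' - W \<in> frob_compl n T" using frob_compl_minus assms W' by metis
  moreover have "W' - W \<in> T" using assms W' by auto
  ultimately have "W' - W = 0\<^sub>m n n" by (auto simp: frob_compl_def intro: frob_inner_self_eq_0)
  show "W' = W"
  proof (rule eq_matI)
    fix i j assume "i < dim_row W" "j < dim_col W"
    then show "W' $$ (i,j) = W $$ (i,j)"
      using arg_cong[OF \<open>W' - W = 0\<^sub>m n n\<close>, of "\<lambda>A. A $$ (i,j)"] c by auto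
  qed (use c in auto)
qed (use assms in auto)

text \<open>By symmetry of the inner product \<open>W\<close> lies in the complement of the
  complement, and it is the remainder \<open>Z - (Z - W)\<close>.\<close>

lemma frob_proj_compl_eqI:
  assumes "T \<subseteq> carrier_mat n n" "Z \<in> carrier_mat n n" "W \<in> T" "Z - W \<in> frob_compl n T"
  shows "frob_proj n (frob_compl n T) Z = Z - W"
proof (rule frob_proj_eqI)
  have "Z - (Z - W) = W" using assms by (intro eq_matI) auto
  then show "Z - (Z - W) \<in> frob_compl n (frob_compl n T)"
    using assms by (auto simp: frob_compl_def frob_inner_comm[of n W])
qed (use assms frob_compl_subset frob_compl_minus in auto)

text \<open>With \<open>A = P * Z\<close>, \<open>B = Z * Q\<close> and
  \<open>C = P * Z * Q\<close>, both sides reduce to \<open>A + B - C\<close>. This turns membership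
  in \<open>supp\<close> into the vanishing of the one corner that the defining sum omits.\<close>

lemma mult_compl_proj_decomp:
  fixes P Q Z :: "real mat"
  assumes [simp]: "P \<in> carrier_mat n n" "Q \<in> carrier_mat n n" "Z \<in> carrier_mat n n"
  shows "P * Z * Q + P * Z * (1\<^sub>m n - Q) + (1\<^sub>m n - P) * Z * Q
    = Z - (1\<^sub>m n - P) * Z * (1\<^sub>m n - Q)"
proof -
  define A where "A = P * Z"
  define B where "B = Z * Q"
  define C where "C = P * (Z * Q)"
  have [simp]: "A \<in> carrier_mat n n" "B \<in> carrier_mat n n" "C \<in> carrier_mat n n"
    by (auto simp: A_def B_def C_def)
  have AQ: "A * Q = C" and ZQ: "Z * Q = B"
    by (simp_all add: A_def B_def C_def assoc_mult_mat[of _ n n _ n _ n])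
  have "P * Z * (1\<^sub>m n - Q) = A - C"
    by (simp add: A_def[symmetric] mult_minus_distrib_mat[of _ n n _ n] AQ
        right_mult_one_mat[of _ n n])
  moreover have "(1\<^sub>m n - P) * Z = Z - A"
    by (simp add: A_def minus_mult_distrib_mat[of _ n n _ _ n] left_mult_one_mat[of _ n n])
  moreover have "(Z - A) * Q = B - C"
    by (simp add: minus_mult_distrib_mat[of _ n n _ _ n] AQ ZQ)
  moreover have "(Z - A) * (1\<^sub>m n - Q) = (Z - A) - (B - C)"
    by (simp add: mult_minus_distrib_mat[of "Z - A" n n _ n] calculation(3)
        right_mult_one_mat[of _ n n])
  moreover have "A + B - C = Z - ((Z - A) - (B - C))"
    by (intro eq_matI) (auto simp: carrier_matD[of A n n] carrier_matD[of B n n] carrier_matD[of C n n]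
      carrier_matD[of Z n n])
  moreover have "P * Z * Q = C" by (simp add: A_def[symmetric] AQ)
  moreover have "C + (A - C) + (B - C) = A + B - C"
    by (intro eq_matI) (auto simp: carrier_matD[of A n n] carrier_matD[of B n n] carrier_matD[of C n n])
  ultimately show ?thesis by simp
qed

lemma minus_eq_self_iff:
  fixes Z W :: "real mat"
  assumes "Z \<in> carrier_mat n n" "W \<in> carrier_mat n n"
  shows "Z = Z - W \<longleftrightarrow> W = 0\<^sub>m n n"
proof
  assume eq: "Z = Z - W"
  show "W = 0\<^sub>m n n"
  proof (rule eq_matI)
    fix i j assume "i < dim_row (0\<^sub>m n n :: real mat)" "j < dim_col (0\<^sub>m n n :: real mat)"
    then show "W $$ (i,j) = 0\<^sub>m n n $$ (i,j)"
      using arg_cong[OF eq, of "\<lambda>A. A $$ (i,j)"] assms by auto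
  qed (use assms in auto)
next
  assume "W = 0\<^sub>m n n"
  with assms show "Z = Z - W" by (intro eq_matI) auto
qed

lemma compl_idempotent:
  fixes R :: "'a::ring_1 mat"
  assumes "R \<in> carrier_mat n n" "R * R = R"
  shows "(1\<^sub>m n - R) * (1\<^sub>m n - R) = 1\<^sub>m n - R"
proof -
  have "(1\<^sub>m n - R) * (1\<^sub>m n - R) = 1\<^sub>m n - R - (R - R * R)"
    using assms(1) by (simp add: minus_mult_distrib_mat[of _ n n _ _ n]
        mult_minus_distrib_mat[of _ n n _ n] left_mult_one_mat[of _ n n] right_mult_one_mat[of _ n n])
  then show ?thesis unfolding assms(2) using assms(1) by (intro eq_matI) auto
qed

text \<open>The support is the kernel of the map sending \<open>Z\<close> to
  \<open>P' * Z * Q'\<close>. As \<open>P'\<close> and \<open>Q'\<close> are symmetric idempotents,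
  this map is a self-adjoint idempotent, hence the projection onto the complement of its
  kernel.\<close>

lemma frob_proj_supp:
  assumes svd: "reduced_svd Y k U S V" and "Y \<in> carrier_mat n n" and Z: "Z \<in> carrier_mat n n"
  defines "P' \<equiv> 1\<^sub>m n - U * U\<^sup>T" and "Q' \<equiv> 1\<^sub>m n - V * V\<^sup>T"
  shows "frob_proj n (supp n Y) Z = Z - P' * Z * Q'"
    and "frob_proj n (frob_compl n (supp n Y)) Z = P' * Z * Q'"
proof -
  have dims [simp]: "dim_row U = n" "dim_row V = n" "dim_col U = k" "dim_col V = k"
    using reduced_svdD(1-4)[OF svd] assms(2) by auto
  have UV [simp]: "U * U\<^sup>T \<in> carrier_mat n n" "V * V\<^sup>T \<in> carrier_mat n n" by auto
  have PQ [simp]: "P' \<in> carrier_mat n n" "Q' \<in> carrier_mat n n"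
    by (auto simp: P'_def Q'_def)
  have sym: "P'\<^sup>T = P'" "Q'\<^sup>T = Q'"
    by (simp_all add: P'_def Q'_def transpose_minus[of _ n n] transpose_mult_dim)
  have "U * U\<^sup>T * (U * U\<^sup>T) = U * U\<^sup>T" "V * V\<^sup>T * (V * V\<^sup>T) = V * V\<^sup>T"
    by (simp_all add: mult_mat_assoc_dim mult_mat_cancel[OF reduced_svdD(5)[OF svd]]
        mult_mat_cancel[OF reduced_svdD(6)[OF svd]])
  then have idem: "P' * P' = P'" "Q' * Q' = Q'"
    by (simp_all add: P'_def Q'_def compl_idempotent[OF UV(1)] compl_idempotent[OF UV(2)])
  have supp: "supp n Y = {Z \<in> carrier_mat n n. P' * Z * Q' = 0\<^sub>m n n}"
    by (auto simp: supp_def Let_def svd_bases_unique[OF svd] mult_compl_proj_decomp[of _ n]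
        minus_eq_self_iff[of _ n] P'_def Q'_def)
  have W: "Z - P' * Z * Q' \<in> supp n Y"
  proof -
    have "P' * (Z - P' * Z * Q') * Q' = P' * Z * Q' - (P' * P') * Z * (Q' * Q')"
      using Z by (simp add: mult_minus_distrib_mat[of _ n n _ n] minus_mult_distrib_mat[of _ n n _ _ n]
          assoc_mult_mat[of _ n n _ n _ n])
    also have "\<dots> = 0\<^sub>m n n" unfolding idem using Z by (simp add: minus_r_inv_mat[of _ n n])
    finally show ?thesis using Z by (auto simp: supp)
  qed
  have ZW: "Z - (Z - P' * Z * Q') = P' * Z * Q'" using Z by (intro eq_matI) auto
  have compl: "P' * Z * Q' \<in> frob_compl n (supp n Y)"
  proof -
    have "frob_inner n (P' * Z * Q') W = 0" if "W \<in> carrier_mat n n" "P' * W * Q' = 0\<^sub>m n n" for W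
    proof -
      have "frob_inner n (P' * Z * Q') W = frob_inner n (P' * Z) (W * Q')"
        using that Z by (subst frob_inner_adjoint_right) (auto simp: sym)
      also have "\<dots> = frob_inner n Z (P' * (W * Q'))"
        using that Z by (subst frob_inner_adjoint_left) (auto simp: sym)
      also have "P' * (W * Q') = 0\<^sub>m n n" using that by (simp add: assoc_mult_mat[of _ n n _ n _ n])
      finally show ?thesis by (simp add: frob_inner_def)
    qed
    then show ?thesis using Z by (auto simp: frob_compl_def supp)
  qed
  have diff: "A - B \<in> supp n Y" if "A \<in> supp n Y" "B \<in> supp n Y" for A B
  proof -
    have "P' * (A - B) * Q' = P' * A * Q' - P' * B * Q'"
      using that by (simp add: supp mult_minus_distrib_mat[of _ n n _ n]
          minus_mult_distrib_mat[of _ n n _ _ n])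
    then show ?thesis using that by (auto simp: supp)
  qed
  show "frob_proj n (supp n Y) Z = Z - P' * Z * Q'"
    by (rule frob_proj_eqI) (use diff W compl ZW Z supp in auto)
  show "frob_proj n (frob_compl n (supp n Y)) Z = P' * Z * Q'"
    by (subst ZW[symmetric], rule frob_proj_compl_eqI) (use W compl ZW Z supp in auto)
qed

lemma frob_proj_supp_carrier:
  assumes "reduced_svd Y k U S V" "Y \<in> carrier_mat n n" "Z \<in> carrier_mat n n"
  shows "frob_proj n (supp n Y) Z \<in> carrier_mat n n"
    and "frob_proj n (frob_compl n (supp n Y)) Z \<in> carrier_mat n n"
proof -
  have "dim_row U = n" "dim_row V = n" using reduced_svdD(1,3)[OF assms(1)] assms(2) by auto
  then have "1\<^sub>m n - U * U\<^sup>T \<in> carrier_mat n n" "1\<^sub>m n - V * V\<^sup>T \<in> carrier_mat n n" by auto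
  then show "frob_proj n (supp n Y) Z \<in> carrier_mat n n"
    and "frob_proj n (frob_compl n (supp n Y)) Z \<in> carrier_mat n n"
    unfolding frob_proj_supp[OF assms] using assms(3) by auto
qed

section \<open>Projections onto column spaces\<close>

lemma scalar_prod_self_eq_0:
  fixes v :: "real vec"
  assumes "v \<bullet> v = 0" "v \<in> carrier_vec n"
  shows "v = 0\<^sub>v n"
  using assms by (intro eq_vecI)
    (auto simp: scalar_prod_def sum_nonneg_eq_0_iff)

lemma vec_compl_minus:
  "x \<in> vec_compl n S \<Longrightarrow> y \<in> vec_compl n S \<Longrightarrow> S \<subseteq> carrier_vec n \<Longrightarrow> x - y \<in> vec_compl n S"
  by (auto simp: vec_compl_def minus_scalar_prod_distrib[of _ n] subset_iff)

text \<open>As for matrices, the two images of \<open>x\<close> differ by a vector in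
  \<open>S\<close> and its complement, hence by zero; unit vectors then identify the matrix
  entries.\<close>

lemma proj_mat_eqI:
  assumes S: "S \<subseteq> carrier_vec n" "\<And>x y. x \<in> S \<Longrightarrow> y \<in> S \<Longrightarrow> x - y \<in> S"
    and P: "P \<in> carrier_mat n n"
    and PS: "\<And>x. x \<in> carrier_vec n \<Longrightarrow> P *\<^sub>v x \<in> S \<and> x - P *\<^sub>v x \<in> vec_compl n S"
  shows "proj_mat n S = P"
  unfolding proj_mat_def
proof (rule the_equality)
  fix P' assume P': "P' \<in> carrier_mat n n \<and>
    (\<forall>x\<in>carrier_vec n. P' *\<^sub>v x \<in> S \<and> x - P' *\<^sub>v x \<in> vec_compl n S)"
  have eq: "P' *\<^sub>v x = P *\<^sub>v x" if x: "x \<in> carrier_vec n" for x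
  proof -
    let ?d = "P' *\<^sub>v x - P *\<^sub>v x"
    have car: "P' *\<^sub>v x \<in> carrier_vec n" "P *\<^sub>v x \<in> carrier_vec n" using P P' x by auto
    have "(x - b) - (x - a) = a - b" if "a \<in> carrier_vec n" "b \<in> carrier_vec n" for a b
      using that x by (intro eq_vecI) auto
    from this[OF car] have "(x - P *\<^sub>v x) - (x - P' *\<^sub>v x) = ?d" .
    then have "?d \<in> vec_compl n S" using vec_compl_minus[OF _ _ S(1)] PS P' x by metis
    moreover have "?d \<in> S" using S(2) PS P' x by blast
    ultimately have "?d = 0\<^sub>v n" by (auto simp: vec_compl_def intro: scalar_prod_self_eq_0)
    moreover have "a = b" if "a - b = 0\<^sub>v n" "a \<in> carrier_vec n" "b \<in> carrier_vec n" for a b :: "real vec"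
    proof (rule eq_vecI)
      show "a $ i = b $ i" if "i < dim_vec b" for i
        using that arg_cong[OF \<open>a - b = 0\<^sub>v n\<close>, of "\<lambda>v. v $ i"] \<open>b \<in> carrier_vec n\<close> by auto
    qed (use that in auto)
    ultimately show ?thesis using car by blast
  qed
  show "P' = P"
  proof (rule eq_matI)
    fix i j assume "i < dim_row P" "j < dim_col P"
    then have ij: "i < n" "j < n" using P by auto
    then show "P' $$ (i,j) = P $$ (i,j)"
      using arg_cong[OF eq[of "unit_vec n j"], of "\<lambda>v. v $ i"] P P' by auto
  qed (use P P' in auto)
qed (use assms in auto)

text \<open>The elements of \<open>S\<close> are the vectors \<open>W *\<^sub>v a\<close>, so
  orthogonality to \<open>S\<close> means being killed by \<open>W\<^sup>T\<close>, and
  orthonormality of the columns gives this for the remainder. For the complement, projection and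
  remainder swap roles, because \<open>S\<close> lies in its double complement.\<close>

lemma proj_mat_orthonormal_basis:
  assumes "orthonormal_basis n k W S"
  shows "proj_mat n S = W * W\<^sup>T" and "proj_mat n (vec_compl n S) = 1\<^sub>m n - W * W\<^sup>T"
proof -
  interpret vec_space "TYPE(real)" n .
  have W: "W \<in> carrier_mat n k" "W\<^sup>T * W = 1\<^sub>m k" "col_space W = S"
    using assms by (auto simp: orthonormal_basis_def)
  have S: "S = {y \<in> carrier_vec n. \<exists>x\<in>carrier_vec k. W *\<^sub>v x = y}"
    using col_space_eq[OF W(1)] W by auto
  have sub: "S \<subseteq> carrier_vec n" by (auto simp: S)
  have diff: "x - y \<in> S" if "x \<in> S" "y \<in> S" for x y
  proof -
    obtain a b where "a \<in> carrier_vec k" "b \<in> carrier_vec k" "W *\<^sub>v a = x" "W *\<^sub>v b = y"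
      using \<open>x \<in> S\<close> \<open>y \<in> S\<close> unfolding S by blast
    then have "a - b \<in> carrier_vec k" "W *\<^sub>v (a - b) = x - y"
      using W(1) by (auto simp: mult_minus_distrib_mat_vec)
    then show ?thesis using that by (auto simp: S)
  qed
  have PS: "(W * W\<^sup>T) *\<^sub>v x \<in> S" if "x \<in> carrier_vec n" for x
    using W(1) that by (auto simp: S assoc_mult_mat_vec[of _ n k _ n] intro!: bexI[of _ "W\<^sup>T *\<^sub>v x"])
  have compl: "x - (W * W\<^sup>T) *\<^sub>v x \<in> vec_compl n S" if x: "x \<in> carrier_vec n" for x
  proof -
    have "(x - (W * W\<^sup>T) *\<^sub>v x) \<bullet> (W *\<^sub>v a) = 0" if a: "a \<in> carrier_vec k" for a
    proof -
      have Wt: "W\<^sup>T \<in> carrier_mat k n" using W(1) by simp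
      have "W\<^sup>T *\<^sub>v (x - (W * W\<^sup>T) *\<^sub>v x) = W\<^sup>T *\<^sub>v x - (W\<^sup>T * W) *\<^sub>v (W\<^sup>T *\<^sub>v x)"
        using W(1) x Wt
        by (simp add: mult_minus_distrib_mat_vec[OF Wt] assoc_mult_mat_vec[of _ n k _ n]
            assoc_mult_mat_vec[of _ k n _ k])
      also have "\<dots> = 0\<^sub>v k" using W(1) x Wt by (simp add: W(2))
      finally have "W\<^sup>T *\<^sub>v (x - (W * W\<^sup>T) *\<^sub>v x) = 0\<^sub>v k" .
      then show ?thesis
        using transpose_vec_mult_scalar[OF W(1) a, of "x - (W * W\<^sup>T) *\<^sub>v x"] W(1) x a by simp
    qed
    then show ?thesis using W(1) x by (auto simp: vec_compl_def S)
  qed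
  show "proj_mat n S = W * W\<^sup>T"
    by (rule proj_mat_eqI) (use sub diff PS compl W(1) in auto)
  show "proj_mat n (vec_compl n S) = 1\<^sub>m n - W * W\<^sup>T"
  proof (rule proj_mat_eqI)
    fix x :: "real vec" assume x: "x \<in> carrier_vec n"
    have e: "(1\<^sub>m n - W * W\<^sup>T) *\<^sub>v x = x - (W * W\<^sup>T) *\<^sub>v x"
      using x W(1) by (subst minus_mult_distrib_mat_vec[of _ n n]) auto
    have "x - (x - (W * W\<^sup>T) *\<^sub>v x) = (W * W\<^sup>T) *\<^sub>v x" using x W(1) by (intro eq_vecI) auto
    moreover have "y \<in> vec_compl n (vec_compl n S)" if "y \<in> S" for y
      using that sub by (auto simp: vec_compl_def) (metis comm_scalar_prod subsetD)
    ultimately show "(1\<^sub>m n - W * W\<^sup>T) *\<^sub>v x \<in> vec_compl n S \<and>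
      x - (1\<^sub>m n - W * W\<^sup>T) *\<^sub>v x \<in> vec_compl n (vec_compl n S)"
      using compl[OF x] PS[OF x] by (simp add: e)
  qed (use W(1) vec_compl_minus sub in \<open>auto simp: vec_compl_def\<close>)
qed

section \<open>Factorisation of the weighted operator\<close>

lemma h_w_factor:
  fixes P Q Z :: "real mat"
  assumes c: "P \<in> carrier_mat n n" "P' \<in> carrier_mat n n" "Q \<in> carrier_mat n n"
    "Q' \<in> carrier_mat n n" "Z \<in> carrier_mat n n"
    and w: "w1 \<noteq> 0" "w3 \<noteq> 0" "w4 = w2 * w3 / w1"
  shows "w1 \<cdot>\<^sub>m (P * Z * Q) + w2 \<cdot>\<^sub>m (P * Z * Q') + w3 \<cdot>\<^sub>m (P' * Z * Q) + w4 \<cdot>\<^sub>m (P' * Z * Q')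
    = (1 / w3) \<cdot>\<^sub>m ((w1 \<cdot>\<^sub>m P + w3 \<cdot>\<^sub>m P') * Z * (w3 \<cdot>\<^sub>m Q + w4 \<cdot>\<^sub>m Q'))"
proof -
  note [simp] = c
  define A where "A = P * Z * Q"
  define B where "B = P * Z * Q'"
  define C where "C = P' * Z * Q"
  define D where "D = P' * Z * Q'"
  have car [simp]: "A \<in> carrier_mat n n" "B \<in> carrier_mat n n" "C \<in> carrier_mat n n"
    "D \<in> carrier_mat n n" by (auto simp: A_def B_def C_def D_def)
  have "(w1 \<cdot>\<^sub>m P + w3 \<cdot>\<^sub>m P') * Z = w1 \<cdot>\<^sub>m (P * Z) + w3 \<cdot>\<^sub>m (P' * Z)"
    by (simp add: add_mult_distrib_mat[of _ n n _ _ n] mult_smult_assoc_mat[of _ n n _ n])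
  moreover have "(w1 \<cdot>\<^sub>m (P * Z) + w3 \<cdot>\<^sub>m (P' * Z)) * M = w1 \<cdot>\<^sub>m (P * Z * M) + w3 \<cdot>\<^sub>m (P' * Z * M)"
    if "M \<in> carrier_mat n n" for M
    using that by (simp add: add_mult_distrib_mat[of _ n n _ _ n] mult_smult_assoc_mat[of _ n n _ n]
        del: assoc_mult_mat)
  moreover have "M * (w3 \<cdot>\<^sub>m Q + w4 \<cdot>\<^sub>m Q') = w3 \<cdot>\<^sub>m (M * Q) + w4 \<cdot>\<^sub>m (M * Q')"
    if "M \<in> carrier_mat n n" for M
    using that by (simp add: mult_add_distrib_mat[of _ n n _ n] mult_smult_distrib[of _ n n _ n]
        del: assoc_mult_mat)
  ultimately have "(w1 \<cdot>\<^sub>m P + w3 \<cdot>\<^sub>m P') * Z * (w3 \<cdot>\<^sub>m Q + w4 \<cdot>\<^sub>m Q')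
    = w3 \<cdot>\<^sub>m (w1 \<cdot>\<^sub>m A + w3 \<cdot>\<^sub>m C) + w4 \<cdot>\<^sub>m (w1 \<cdot>\<^sub>m B + w3 \<cdot>\<^sub>m D)"
    by (simp add: A_def B_def C_def D_def del: assoc_mult_mat)
  \<comment> \<open>The choice of \<open>w4\<close> enters here: the coefficient of \<open>B\<close>
    on the right is \<open>w1 * w4 / w3\<close>, which equals \<open>w2\<close>.\<close>
  moreover have "w1 \<cdot>\<^sub>m A + w2 \<cdot>\<^sub>m B + w3 \<cdot>\<^sub>m C + w4 \<cdot>\<^sub>m D
    = (1 / w3) \<cdot>\<^sub>m (w3 \<cdot>\<^sub>m (w1 \<cdot>\<^sub>m A + w3 \<cdot>\<^sub>m C) + w4 \<cdot>\<^sub>m (w1 \<cdot>\<^sub>m B + w3 \<cdot>\<^sub>m D))"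
    using car[THEN carrier_matD(1)] car[THEN carrier_matD(2)] w(1,2)
    by (intro eq_matI) (auto simp: w(3) field_simps)
  ultimately show ?thesis unfolding A_def B_def C_def D_def by simp
qed

section \<open>The angle and rotation blocks\<close>

text \<open>Taking leading columns becomes right multiplication by this matrix, so column selection
  takes part in associativity and transposition rewriting.\<close>

definition first_cols :: "nat \<Rightarrow> nat \<Rightarrow> real mat" where
  "first_cols n r = mat n r (\<lambda>(i,j). if i = j then 1 else 0)"

lemma first_cols_dims [simp]:
  "first_cols n r \<in> carrier_mat n r" "dim_row (first_cols n r) = n" "dim_col (first_cols n r) = r"
  by (simp_all add: first_cols_def)

lemma mult_first_cols:
  assumes "M \<in> carrier_mat m n" "r \<le> n"
  shows "M * first_cols n r = mat m r (\<lambda>(i,j). M $$ (i,j))"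
  using assms by (intro eq_matI) (auto simp: first_cols_def scalar_prod_def if_distrib cong: if_cong)

lemma mult_first_cols_eqI:
  assumes "B \<in> carrier_mat m n" "U \<in> carrier_mat m r" "r \<le> n" "\<forall>j<r. col B j = col U j"
  shows "U = B * first_cols n r"
proof (rule eq_matI)
  fix i j assume "i < dim_row (B * first_cols n r)" "j < dim_col (B * first_cols n r)"
  then have ij: "i < m" "j < r" using assms by auto
  then have "U $$ (i,j) = col U j $ i" "B $$ (i,j) = col B j $ i" using assms(1-3) by auto
  then show "U $$ (i,j) = (B * first_cols n r) $$ (i,j)"
    using ij assms(4) by (simp add: mult_first_cols[OF assms(1,3)])
qed (use assms in auto)

lemma first_cols_orthonormal:
  assumes "r \<le> n" shows "(first_cols n r)\<^sup>T * first_cols n r = 1\<^sub>m r"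
  using assms by (subst mult_first_cols[of _ r n]) (auto simp: first_cols_def)

lemma padded_id_eq:
  assumes "r \<le> n" shows "padded_id n r = first_cols n r * (first_cols n r)\<^sup>T"
  using assms
  by (intro eq_matI)
    (auto simp: padded_id_def first_cols_def scalar_prod_def if_distrib cong: if_cong)

lemma reduced_svd_padded_id:
  assumes "r \<le> n"
  shows "reduced_svd (padded_id n r) r (first_cols n r) (1\<^sub>m r) (first_cols n r)"
  using assms unfolding reduced_svd_def
  by (auto simp: padded_id_eq first_cols_orthonormal diagonal_mat_def right_mult_one_mat[of _ n r])

section \<open>Entries of the angle and rotation matrices\<close>

lemma angle_block_carrier:
  assumes "r \<le> r'" "r + r' \<le> n"
  shows "angle_block n r r' \<theta> \<in> carrier_mat n r'"
  using assms by (auto simp: angle_block_def cos_mat_def sin_mat_def append_rows_def)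

lemma angle_block_index:
  assumes "r \<le> r'" "r + r' \<le> n" "i < n" "j < r"
  shows "angle_block n r r' \<theta> $$ (i,j) =
    (if i = j then cos (\<theta> (r - j)) else if i = r + j then - sin (\<theta> (r - j)) else 0)"
  using assms
  by (auto simp: angle_block_def cos_mat_def sin_mat_def append_rows_def mat_diag_def)

text \<open>Complements \<open>angle_block_index\<close>: these are the rows that
  \<open>A\<^sup>T * E\<close> reads, across all \<open>r'\<close> columns.\<close>

lemma angle_block_top:
  assumes "r \<le> r'" "r + r' \<le> n" "i < r" "j < r'"
  shows "angle_block n r r' \<theta> $$ (i,j) = (if i = j then cos (\<theta> (r - j)) else 0)"
  using assms by (auto simp: angle_block_def cos_mat_def sin_mat_def append_rows_def mat_diag_def)

lemma O_mat_index:
  fixes \<theta> :: "nat \<Rightarrow> real"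
  assumes "r \<le> r'" "r + r' \<le> n" "i < n" "j < r"
  defines "c \<equiv> cos (\<theta> (r - j))" and "s \<equiv> sin (\<theta> (r - j))"
  shows "O_mat n r r' a b \<theta> $$ (i,j) =
    (if i = j then (a * c\<^sup>2 + b * s\<^sup>2) / sqrt (a\<^sup>2 * c\<^sup>2 + b\<^sup>2 * s\<^sup>2)
     else if i = r + j then (b - a) * s * c / sqrt (a\<^sup>2 * c\<^sup>2 + b\<^sup>2 * s\<^sup>2) else 0)"
  using assms by (auto simp: O_mat_def O_block_def Let_def mat_diag_def)

section \<open>Orthogonality of the rotation matrices\<close>

lemma four_block_diag_orthogonal:
  fixes A B :: "'a::comm_ring_1 mat"
  assumes "A \<in> carrier_mat k k" "B \<in> carrier_mat l l" "A\<^sup>T * A = 1\<^sub>m k" "B\<^sup>T * B = 1\<^sub>m l"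
  defines "M \<equiv> four_block_mat A (0\<^sub>m k l) (0\<^sub>m l k) B"
  shows "M\<^sup>T * M = 1\<^sub>m (k + l)"
proof -
  have "M\<^sup>T = four_block_mat A\<^sup>T (0\<^sub>m k l) (0\<^sub>m l k) B\<^sup>T"
    unfolding M_def using assms by (subst transpose_four_block_mat[of _ k k _ l _ l]) auto
  then have "M\<^sup>T * M = four_block_mat (1\<^sub>m k) (0\<^sub>m k l) (0\<^sub>m l k) (1\<^sub>m l)"
    unfolding M_def using assms by (simp add: mult_four_block_mat[of _ k k _ l _ l _ _ k _ l])
  also have "\<dots> = 1\<^sub>m (k + l)" by (intro eq_matI) auto
  finally show ?thesis .
qed

text \<open>Guarantees that the denominators in \<open>O_block\<close> do not vanish. Where the
  cosine is zero, the squared sine is one.\<close>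

lemma weighted_cos_sin_pos:
  fixes a b t :: real
  assumes "a > 0" "b > 0"
  shows "a\<^sup>2 * (cos t)\<^sup>2 + b\<^sup>2 * (sin t)\<^sup>2 > 0"
proof (cases "cos t = 0")
  case True
  then have "(sin t)\<^sup>2 = 1" using sin_cos_squared_add[of t] by simp
  then show ?thesis using assms True by simp
next
  case False
  then show ?thesis using assms by (intro add_pos_nonneg) auto
qed

lemma O_block_carrier: "O_block r a b \<theta> \<in> carrier_mat (r + r) (r + r)"
  by (auto simp: O_block_def Let_def)

text \<open>The block has rows [f, g] and [-g, f] with diagonal, hence commuting, entries, so
  orthogonality reduces to \<open>f i * f i + g i * g i = 1\<close> for each angle.\<close>

lemma O_block_orthogonal:
  assumes "a > 0" "b > 0"
  shows "(O_block r a b \<theta>)\<^sup>T * O_block r a b \<theta> = 1\<^sub>m (r + r)"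
proof -
  define c where "c i = cos (\<theta> (r - i))" for i
  define s where "s i = sin (\<theta> (r - i))" for i
  define C where "C i = sqrt (a\<^sup>2 * (c i)\<^sup>2 + b\<^sup>2 * (s i)\<^sup>2)" for i
  define f where "f i = (a * (c i)\<^sup>2 + b * (s i)\<^sup>2) / C i" for i
  define g where "g i = (a - b) * s i * c i / C i" for i
  have h: "(b - a) * s i * c i / C i = - g i" for i by (simp add: g_def algebra_simps diff_divide_distrib)
  have O: "O_block r a b \<theta> =
    four_block_mat (mat_diag r f) (mat_diag r g) (mat_diag r (\<lambda>i. - g i)) (mat_diag r f)"
    unfolding O_block_def Let_def
    by (simp add: f_def[symmetric] g_def[symmetric] C_def[symmetric] c_def[symmetric]
        s_def[symmetric] h cong: if_cong)
  have quot: "x / z * (x / z) + y / z * (y / z) = (x\<^sup>2 + y\<^sup>2) / (z * z)" for x y z :: real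
    by (simp add: add_divide_distrib power2_eq_square)
  have fg: "f i * f i + g i * g i = 1" for i
  proof -
    have C2: "C i * C i = a\<^sup>2 * (c i)\<^sup>2 + b\<^sup>2 * (s i)\<^sup>2" and "C i > 0"
      using weighted_cos_sin_pos[OF assms, of "\<theta> (r - i)"] by (simp_all add: C_def c_def s_def)
    \<comment> \<open>Lagrange's identity for the vectors \<open>(a * c i, b * s i)\<close> and
      \<open>(c i, s i)\<close>.\<close>
    have "(a * (c i)\<^sup>2 + b * (s i)\<^sup>2)\<^sup>2 + ((a - b) * s i * c i)\<^sup>2
      = (a\<^sup>2 * (c i)\<^sup>2 + b\<^sup>2 * (s i)\<^sup>2) * ((c i)\<^sup>2 + (s i)\<^sup>2)"
      by (simp add: power2_eq_square algebra_simps)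
    also have "(c i)\<^sup>2 + (s i)\<^sup>2 = 1" by (simp add: c_def s_def)
    finally have "(a * (c i)\<^sup>2 + b * (s i)\<^sup>2)\<^sup>2 + ((a - b) * s i * c i)\<^sup>2 = C i * C i"
      by (simp add: C2)
    moreover have "f i * f i + g i * g i
      = ((a * (c i)\<^sup>2 + b * (s i)\<^sup>2)\<^sup>2 + ((a - b) * s i * c i)\<^sup>2) / (C i * C i)"
      unfolding f_def g_def by (rule quot)
    ultimately show ?thesis using \<open>C i > 0\<close> by simp
  qed
  have diag_add: "mat_diag r u + mat_diag r v = mat_diag r (\<lambda>i. u i + v i)" for u v :: "nat \<Rightarrow> real"
    by (intro eq_matI) (auto simp: mat_diag_def)
  have diag_0: "mat_diag r (\<lambda>i. 0) = (0\<^sub>m r r :: real mat)"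
    by (intro eq_matI) (auto simp: mat_diag_def)
  show ?thesis
    unfolding O
    by (simp add: transpose_four_block_mat[of _ r r _ r _ r] mult_four_block_mat[of _ r r _ r _ r _ _ r _ r]
        diag_add fg diag_0 add.commute)
qed

text \<open>\<open>diag_block_mat\<close> nests its blocks and ends with an empty one; merging the
  trailing identities gives the two-block form that \<open>four_block_diag_orthogonal\<close>
  handles.\<close>

lemma O_mat_alt: "O_mat n r r' a b \<theta> =
    four_block_mat (O_block r a b \<theta>) (0\<^sub>m (r + r) ((r' - r) + (n - r - r')))
      (0\<^sub>m ((r' - r) + (n - r - r')) (r + r)) (1\<^sub>m ((r' - r) + (n - r - r')))"
proof -
  have "four_block_mat (1\<^sub>m k) (0\<^sub>m k l) (0\<^sub>m l k) (1\<^sub>m l) = (1\<^sub>m (k + l) :: real mat)"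
    "four_block_mat (1\<^sub>m k) (0\<^sub>m k 0) (0\<^sub>m 0 k) (0\<^sub>m 0 0) = (1\<^sub>m k :: real mat)" for k l
    by (intro eq_matI; auto)+
  then show ?thesis using O_block_carrier[of r a b \<theta>] by (simp add: O_mat_def Let_def)
qed

lemma O_mat_carrier:
  assumes "r \<le> r'" "r + r' \<le> n"
  shows "O_mat n r r' a b \<theta> \<in> carrier_mat n n"
  using assms O_block_carrier[of r a b \<theta>] by (auto simp: O_mat_alt)

lemma O_mat_orthogonal:
  assumes "r \<le> r'" "r + r' \<le> n" "a > 0" "b > 0"
  shows "(O_mat n r r' a b \<theta>)\<^sup>T * O_mat n r r' a b \<theta> = 1\<^sub>m n"
proof -
  have "r + r + ((r' - r) + (n - r - r')) = n" using assms by simp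
  then show ?thesis
    using four_block_diag_orthogonal[OF O_block_carrier one_carrier_mat O_block_orthogonal[OF assms(3,4)],
        of "(r' - r) + (n - r - r')" r \<theta>]
    by (simp add: O_mat_alt)
qed

text \<open>Let c and s be the cosine and sine belonging to column \<open>j\<close>. Projecting the
  unit vector e_j gives c (c e_j - s e_(r+j)), so the weighted sum is (a c^2 + b s^2) e_j + (b - a)
  s c e_(r+j). Its length is the square root on the right, and normalising it gives column
  \<open>j\<close> of \<open>O_mat\<close>.\<close>

lemma weighted_proj_angle_block:
  fixes \<theta> :: "nat \<Rightarrow> real"
  assumes rr: "r \<le> r'" "r + r' \<le> n" and ab: "a > 0" "b > 0"
  defines "A \<equiv> angle_block n r r' \<theta>" and "E \<equiv> first_cols n r"
  shows "a \<cdot>\<^sub>m (A * (A\<^sup>T * E)) + b \<cdot>\<^sub>m (E - A * (A\<^sup>T * E)) = O_mat n r r' a b \<theta> *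
    (E * mat_diag r (\<lambda>j. sqrt (a\<^sup>2 * (cos (\<theta> (r - j)))\<^sup>2 + b\<^sup>2 * (sin (\<theta> (r - j)))\<^sup>2)))"
    (is "_ = ?O * (E * mat_diag r ?C)")
proof -
  have A: "A \<in> carrier_mat n r'" using angle_block_carrier[OF rr] by (simp add: A_def)
  have O: "?O \<in> carrier_mat n n" using O_mat_carrier[OF rr] .
  have "r \<le> n" using rr by simp
  \<comment> \<open>The first \<open>r\<close> rows of \<open>A\<close> vanish off the diagonal, so
    multiplying by \<open>A\<close> again only rescales its leading columns by the cosines.\<close>
  have "A\<^sup>T * E = first_cols r' r * mat_diag r (\<lambda>j. cos (\<theta> (r - j)))"
    unfolding E_def using A rr
    by (subst mult_first_cols[of _ r' n], simp, simp, subst mat_diag_mult_right[of _ r' r], simp)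
      (auto simp: A_def angle_block_top first_cols_def)
  then have "A * (A\<^sup>T * E) = (A * first_cols r' r) * mat_diag r (\<lambda>j. cos (\<theta> (r - j)))"
    using A by (simp add: mult_mat_assoc_dim)
  also have "\<dots> = mat n r (\<lambda>(i,j). A $$ (i,j) * cos (\<theta> (r - j)))"
    using A rr by (subst mult_first_cols[of _ n r'], simp, simp, subst mat_diag_mult_right[of _ n r])
      (auto)
  finally have X: "A * (A\<^sup>T * E) = \<dots>" .
  have "?O * (E * mat_diag r ?C) = (?O * E) * mat_diag r ?C"
    using O by (simp add: mult_mat_assoc_dim E_def)
  also have "\<dots> = mat n r (\<lambda>(i,j). ?O $$ (i,j) * ?C j)"
    using O \<open>r \<le> n\<close> unfolding E_def
    by (subst mult_first_cols[of _ n n], simp, simp, subst mat_diag_mult_right[of _ n r])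
      (auto)
  finally have Y: "?O * (E * mat_diag r ?C) = \<dots>" .
  have C: "?C j > 0" for j using weighted_cos_sin_pos[OF ab] by simp
  have sc: "(sin t)\<^sup>2 = 1 - (cos t)\<^sup>2" for t :: real by (rule sin_squared_eq)
  show ?thesis
  proof (rule eq_matI)
    fix i j assume "i < dim_row (?O * (E * mat_diag r ?C))" "j < dim_col (?O * (E * mat_diag r ?C))"
    then have ij: "i < n" "j < r" using O by (auto simp: E_def)
    have "?O $$ (i,j) * ?C j = (if i = j then a * (cos (\<theta> (r - j)))\<^sup>2 + b * (sin (\<theta> (r - j)))\<^sup>2
      else if i = r + j then (b - a) * sin (\<theta> (r - j)) * cos (\<theta> (r - j)) else 0)"
      using C[of j] by (simp add: O_mat_index[OF rr ij])
    then show "(a \<cdot>\<^sub>m (A * (A\<^sup>T * E)) + b \<cdot>\<^sub>m (E - A * (A\<^sup>T * E))) $$ (i,j) =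
      (?O * (E * mat_diag r ?C)) $$ (i,j)"
      unfolding X Y using ij
      by (simp add: E_def first_cols_def A_def angle_block_index[OF rr ij] sc)
        (auto simp: power2_eq_square algebra_simps)
  qed (use A O in \<open>auto simp: E_def\<close>)
qed

text \<open>The first \<open>r\<close> columns of \<open>O_mat\<close> are the normalised columns of \<open>(a P + b (I - P)) U\<close>
  in the coordinates given by \<open>B\<close>; this is how the formula for \<open>O_mat\<close> arises.\<close>

lemma weighted_proj_orthogonal:
  fixes \<theta> :: "nat \<Rightarrow> real"
  assumes rr: "r \<le> r'" "r + r' \<le> n" and ab: "a > 0" "b > 0"
    and B: "B \<in> carrier_mat n n" "B\<^sup>T * B = 1\<^sub>m n"
  defines "W \<equiv> B * angle_block n r r' \<theta>" and "E \<equiv> first_cols n r"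
  shows "(a \<cdot>\<^sub>m (W * W\<^sup>T) + b \<cdot>\<^sub>m (1\<^sub>m n - W * W\<^sup>T)) * (B * E) = B * (O_mat n r r' a b \<theta> *
    (E * mat_diag r (\<lambda>j. sqrt (a\<^sup>2 * (cos (\<theta> (r - j)))\<^sup>2 + b\<^sup>2 * (sin (\<theta> (r - j)))\<^sup>2))))"
proof -
  define A where "A = angle_block n r r' \<theta>"
  define X where "X = A * (A\<^sup>T * E)"
  have A: "A \<in> carrier_mat n r'" using angle_block_carrier[OF rr] by (simp add: A_def)
  have car: "X \<in> carrier_mat n r" "B * X \<in> carrier_mat n r" "E \<in> carrier_mat n r"
    "B * E \<in> carrier_mat n r" "W * W\<^sup>T \<in> carrier_mat n n"
    using A B by (auto simp: X_def E_def W_def)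
  have PX: "W * W\<^sup>T * (B * E) = B * X"
    using A B by (simp add: W_def A_def[symmetric] X_def E_def mult_mat_assoc_dim transpose_mult_dim
        mult_mat_cancel[OF B(2)])
  have "(a \<cdot>\<^sub>m (W * W\<^sup>T) + b \<cdot>\<^sub>m (1\<^sub>m n - W * W\<^sup>T)) * (B * E)
    = a \<cdot>\<^sub>m (B * X) + b \<cdot>\<^sub>m (B * E - B * X)"
    using car B by (simp add: add_mult_distrib_mat[of _ n n _ _ r] mult_smult_assoc_mat[of _ n n _ r]
        minus_mult_distrib_mat[of _ n n _ _ r] PX left_mult_one_mat[of _ n r] del: assoc_mult_mat)
  also have "\<dots> = B * (a \<cdot>\<^sub>m X + b \<cdot>\<^sub>m (E - X))"
    using car B by (simp add: mult_add_distrib_mat[of _ n n _ r] mult_smult_distrib[of _ n n _ r]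
        mult_minus_distrib_mat[of _ n n _ r])
  finally show ?thesis
    unfolding X_def A_def E_def by (simp only: weighted_proj_angle_block[OF rr ab])
qed

section \<open>The sign and support of the transformed matrix\<close>

text \<open>\<open>L\<close> turns \<open>U\<close> into \<open>U'\<close> up to positive column
  scalings; \<open>R\<close> does the same to \<open>V\<close>, entering through
  \<open>V\<^sup>T * R = (R\<^sup>T * V)\<^sup>T\<close>. The scalings merge with the singular
  values, which stay positive though possibly unsorted.\<close>

lemma reduced_svd_sandwich:
  assumes svd: "reduced_svd X r U S V" and X: "X \<in> carrier_mat n n"
    and LR: "L \<in> carrier_mat n n" "R \<in> carrier_mat n n"
    and UV: "U' \<in> carrier_mat n r" "V' \<in> carrier_mat n r"
    and orth: "U'\<^sup>T * U' = 1\<^sub>m r" "V'\<^sup>T * V' = 1\<^sub>m r"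
    and LU: "L * U = U' * mat_diag r f" and RV: "R\<^sup>T * V = V' * mat_diag r g"
    and pos: "\<And>i. f i > 0" "\<And>i. g i > 0" "c > 0"
  shows "reduced_svd (c \<cdot>\<^sub>m (L * X * R)) r U' (mat_diag r (\<lambda>i. c * (f i * S $$ (i,i) * g i))) V'"
proof -
  have [simp]: "dim_row U = n" "dim_row V = n" "dim_col U = r" "dim_col V = r"
    using reduced_svdD(1-4)[OF svd] X by auto
  have [simp]: "dim_row U' = n" "dim_row V' = n" "dim_col U' = r" "dim_col V' = r"
    "dim_row L = n" "dim_col L = n" "dim_row R = n" "dim_col R = n" using UV LR by auto
  define s where "s i = S $$ (i,i)" for i
  have "S = mat_diag r s" unfolding s_def by (rule reduced_svd_diag[OF svd])
  then have Xs: "X = U * mat_diag r s * V\<^sup>T" using reduced_svdD(8)[OF svd] by (simp only:)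
  have VR: "V\<^sup>T * R = mat_diag r g * V'\<^sup>T"
    using arg_cong[OF RV, of transpose_mat] by (simp add: transpose_mult_dim)
  have dg: "mat_diag r p * (mat_diag r q * V'\<^sup>T) = mat_diag r (\<lambda>i. p i * q i) * V'\<^sup>T" for p q
    by (simp add: mult_mat_assoc_dim[symmetric])
  have "L * X * R = (L * U) * mat_diag r s * (V\<^sup>T * R)"
    unfolding Xs by (simp add: mult_mat_assoc_dim)
  also have "\<dots> = U' * (mat_diag r (\<lambda>i. f i * s i * g i) * V'\<^sup>T)"
    unfolding LU VR by (simp add: mult_mat_assoc_dim dg)
  finally have eq: "L * X * R = U' * (mat_diag r (\<lambda>i. f i * s i * g i) * V'\<^sup>T)" .
  have "V'\<^sup>T \<in> carrier_mat r n" using UV by simp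
  then have "c \<cdot>\<^sub>m (L * X * R) = U' * (mat_diag r (\<lambda>i. c * (f i * s i * g i)) * V'\<^sup>T)"
    unfolding eq smult_mat_diag[symmetric] using UV
    by (simp add: mult_smult_distrib[OF UV(1), of _ n] mult_smult_assoc_mat[of _ r r _ n]
        mult_carrier_mat[of _ r r _ n])
  then show ?thesis
    unfolding reduced_svd_def using UV orth pos reduced_svdD(7)[OF svd] LR
    by (auto simp: diagonal_mat_def mat_diag_def[of r] s_def mult_mat_assoc_dim)
qed

text \<open>The bases of \<open>Y\<close> are those of \<open>padded_id n r\<close> moved by
  \<open>M\<close> and \<open>N\<close>. Since \<open>M * M\<^sup>T = 1\<^sub>m n\<close>, the
  complementary projector of \<open>M * E\<close> is that of \<open>E\<close> conjugated by
  \<open>M\<close>, and likewise for \<open>N\<close>.\<close>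

lemma sgn_supp_orthogonal:
  fixes M N :: "real mat"
  assumes "r \<le> n" and M: "M \<in> carrier_mat n n" "M\<^sup>T * M = 1\<^sub>m n"
    and N: "N \<in> carrier_mat n n" "N\<^sup>T * N = 1\<^sub>m n"
    and Y: "Y \<in> carrier_mat n n" "reduced_svd Y r (M * first_cols n r) S (N * first_cols n r)"
  defines "T \<equiv> supp n (padded_id n r)"
  shows "sgn_mat Y = M * frob_proj n T (1\<^sub>m n) * N\<^sup>T"
    and "Z \<in> carrier_mat n n \<Longrightarrow> frob_proj n (frob_compl n (supp n Y)) Z
      = M * frob_proj n (frob_compl n T) (M\<^sup>T * Z * N) * N\<^sup>T"
proof -
  define E where "E = first_cols n r"
  have [simp]: "dim_row E = n" "dim_col E = r" "dim_row M = n" "dim_col M = n" "dim_row N = n"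
    "dim_col N = n" using M N by (auto simp: E_def)
  have EE: "E\<^sup>T * E = 1\<^sub>m r" using first_cols_orthonormal[OF \<open>r \<le> n\<close>] by (simp add: E_def)
  have pc: "padded_id n r \<in> carrier_mat n n" using \<open>r \<le> n\<close> by (auto simp: padded_id_def)
  define K where "K = E * E\<^sup>T"
  have Kc: "K \<in> carrier_mat n n" by (auto simp: K_def)
  note projT = frob_proj_supp[OF reduced_svd_padded_id[OF \<open>r \<le> n\<close>] pc, folded T_def E_def K_def]
  have "K * K = K" unfolding K_def by (simp add: mult_mat_assoc_dim mult_mat_cancel[OF EE])
  then have KK: "(1\<^sub>m n - K) * (1\<^sub>m n - K) = 1\<^sub>m n - K"
    using Kc compl_idempotent by blast
  \<comment> \<open>The complement of \<open>K\<close> is idempotent, so projecting the identity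
    matrix onto \<open>T\<close> leaves exactly \<open>K\<close>.\<close>
  have "1\<^sub>m n - (1\<^sub>m n - K) * 1\<^sub>m n * (1\<^sub>m n - K) = K"
    using Kc by (simp add: right_mult_one_mat[of _ n n] KK) auto
  then have T1: "frob_proj n T (1\<^sub>m n) = K" using projT(1)[of "1\<^sub>m n"] by simp
  show "sgn_mat Y = M * frob_proj n T (1\<^sub>m n) * N\<^sup>T"
    unfolding T1 sgn_mat_eq[OF Y(2)] E_def[symmetric]
    by (simp add: K_def mult_mat_assoc_dim transpose_mult_dim)
  have conj: "1\<^sub>m n - (M * E) * (M * E)\<^sup>T = M * (1\<^sub>m n - K) * M\<^sup>T"
    if "M \<in> carrier_mat n n" "M\<^sup>T * M = 1\<^sub>m n" for M :: "real mat"
  proof -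
    have [simp]: "dim_row M = n" "dim_col M = n" using that by auto
    have Mt: "M\<^sup>T \<in> carrier_mat n n" using that by simp
    have "M * (1\<^sub>m n - K) * M\<^sup>T = M * M\<^sup>T - M * K * M\<^sup>T"
      using that(1) Kc Mt
      by (simp add: mult_minus_distrib_mat[of _ n n _ n] minus_mult_distrib_mat[of _ n n _ _ n]
          del: assoc_mult_mat)
    also have "\<dots> = 1\<^sub>m n - (M * E) * (M * E)\<^sup>T"
      unfolding orthogonal_mat_inv[OF that] by (simp add: K_def mult_mat_assoc_dim transpose_mult_dim)
    finally show ?thesis by simp
  qed
  show "frob_proj n (frob_compl n (supp n Y)) Z
      = M * frob_proj n (frob_compl n T) (M\<^sup>T * Z * N) * N\<^sup>T" if Z: "Z \<in> carrier_mat n n"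
  proof -
    have [simp]: "dim_row Z = n" "dim_col Z = n" "dim_row K = n" "dim_col K = n" using Z Kc by auto
    have c: "M\<^sup>T * Z * N \<in> carrier_mat n n" using M N Z by auto
    show ?thesis
      unfolding frob_proj_supp(2)[OF Y(2,1) Z] projT(2)[OF c] E_def[symmetric] conj[OF M] conj[OF N]
      by (simp add: mult_mat_assoc_dim)
  qed
qed

theorem corollary1:
  fixes n r r' :: nat
    and X U S V B\<^sub>L B\<^sub>R O\<^sub>L O\<^sub>R :: "real mat"
    and Us Vs :: "real vec set"
    and \<theta>\<^sub>u \<theta>\<^sub>v :: "nat \<Rightarrow> real"
    and w1 w2 w3 w4 :: real
    and That T1 :: "real mat set"
  assumes "r \<le> r'" and "r + r' \<le> n"
    and "X \<in> carrier_mat n n" and "vec_space.rank n X = r"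
    and "reduced_svd X r U S V"
    and "subspace_of_dim n r' Us" and "subspace_of_dim n r' Vs"
    and "principal_angles r (vec_space.col_space n U) Us \<theta>\<^sub>u"
    and "principal_angles r (vec_space.col_space n V) Vs \<theta>\<^sub>v"
    and "B\<^sub>L \<in> carrier_mat n n" and "B\<^sub>L\<^sup>T * B\<^sub>L = 1\<^sub>m n" and "\<forall>j<r. col B\<^sub>L j = col U j"
    and "B\<^sub>R \<in> carrier_mat n n" and "B\<^sub>R\<^sup>T * B\<^sub>R = 1\<^sub>m n" and "\<forall>j<r. col B\<^sub>R j = col V j"
    and "orthonormal_basis n r' (B\<^sub>L * angle_block n r r' \<theta>\<^sub>u) Us"
    and "orthonormal_basis n r' (B\<^sub>R * angle_block n r r' \<theta>\<^sub>v) Vs"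
    and "w1 > 0" and "w2 > 0" and "w3 > 0" and "w4 = w2 * w3 / w1"
    and "O\<^sub>L = O_mat n r r' w1 w3 \<theta>\<^sub>u"
    and "O\<^sub>R = O_mat n r r' w3 w4 \<theta>\<^sub>v"
    and "That = supp n (h_w n w1 w2 w3 w4 Us Vs X)"
    and "T1 = supp n (padded_id n r)"
  shows "sgn_mat (h_w n w1 w2 w3 w4 Us Vs X) =
           B\<^sub>L * O\<^sub>L * frob_proj n T1 (1\<^sub>m n) * O\<^sub>R\<^sup>T * B\<^sub>R\<^sup>T
       \<and> (\<forall>Z\<in>carrier_mat n n.
            frob_proj n (frob_compl n That) Z =
              B\<^sub>L * O\<^sub>L * frob_proj n (frob_compl n T1) (O\<^sub>L\<^sup>T * B\<^sub>L\<^sup>T * Z * B\<^sub>R * O\<^sub>R)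
                * O\<^sub>R\<^sup>T * B\<^sub>R\<^sup>T)"
proof -
  note rr = assms(1,2) and svd = assms(5)
  note BL = assms(10,11) and BR = assms(13,14)
  have "r \<le> n" using rr by simp
  \<comment> \<open>The weights of \<open>O\<^sub>R\<close> are \<open>w3\<close> and
    \<open>w4\<close>; the rotation lemmas ask for both to be positive.\<close>
  have "w4 > 0" using assms(18-21) by simp
  note w = assms(18,20) \<open>w4 > 0\<close>
  define E where "E = first_cols n r"
  define P where "P = proj_mat n Us"
  define Q where "Q = proj_mat n Vs"
  define L where "L = w1 \<cdot>\<^sub>m P + w3 \<cdot>\<^sub>m (1\<^sub>m n - P)"
  define R where "R = w3 \<cdot>\<^sub>m Q + w4 \<cdot>\<^sub>m (1\<^sub>m n - Q)"
  define H where "H = h_w n w1 w2 w3 w4 Us Vs X"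
  define f where "f j = sqrt (w1\<^sup>2 * (cos (\<theta>\<^sub>u (r - j)))\<^sup>2 + w3\<^sup>2 * (sin (\<theta>\<^sub>u (r - j)))\<^sup>2)" for j
  define g where "g j = sqrt (w3\<^sup>2 * (cos (\<theta>\<^sub>v (r - j)))\<^sup>2 + w4\<^sup>2 * (sin (\<theta>\<^sub>v (r - j)))\<^sup>2)" for j
  define M where "M = B\<^sub>L * O\<^sub>L"
  define N where "N = B\<^sub>R * O\<^sub>R"
  have OL: "O\<^sub>L \<in> carrier_mat n n" "O\<^sub>L\<^sup>T * O\<^sub>L = 1\<^sub>m n"
    unfolding assms(22) by (fact O_mat_carrier[OF rr], fact O_mat_orthogonal[OF rr w(1,2)])
  have OR: "O\<^sub>R \<in> carrier_mat n n" "O\<^sub>R\<^sup>T * O\<^sub>R = 1\<^sub>m n"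
    unfolding assms(23) by (fact O_mat_carrier[OF rr], fact O_mat_orthogonal[OF rr w(2,3)])
  have [simp]: "dim_row B\<^sub>L = n" "dim_col B\<^sub>L = n" "dim_row B\<^sub>R = n" "dim_col B\<^sub>R = n"
    "dim_row O\<^sub>L = n" "dim_col O\<^sub>L = n" "dim_row O\<^sub>R = n" "dim_col O\<^sub>R = n" "dim_row E = n" "dim_col E = r"
    using BL(1) BR(1) OL(1) OR(1) by (auto simp: E_def)
  have M: "M \<in> carrier_mat n n" "M\<^sup>T * M = 1\<^sub>m n" and N: "N \<in> carrier_mat n n" "N\<^sup>T * N = 1\<^sub>m n"
    by (auto simp: M_def N_def transpose_mult_dim mult_mat_assoc_dim mult_mat_cancel[OF BL(2)]
        mult_mat_cancel[OF BR(2)] OL(2) OR(2))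
  have EE: "E\<^sup>T * E = 1\<^sub>m r" using first_cols_orthonormal[OF \<open>r \<le> n\<close>] by (simp add: E_def)
  have ME: "M * E \<in> carrier_mat n r" "N * E \<in> carrier_mat n r"
    "(M * E)\<^sup>T * (M * E) = 1\<^sub>m r" "(N * E)\<^sup>T * (N * E) = 1\<^sub>m r"
    using M N by (auto simp: transpose_mult_dim mult_mat_assoc_dim mult_mat_cancel[OF M(2)]
        mult_mat_cancel[OF N(2)] EE)
  have UV: "U \<in> carrier_mat n r" "V \<in> carrier_mat n r"
    using reduced_svdD(1-4)[OF svd] assms(3) by auto
  have U: "U = B\<^sub>L * E" and V: "V = B\<^sub>R * E"
    unfolding E_def
    by (rule mult_first_cols_eqI[OF BL(1) UV(1) \<open>r \<le> n\<close> assms(12)],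
        rule mult_first_cols_eqI[OF BR(1) UV(2) \<open>r \<le> n\<close> assms(15)])
  note pU = proj_mat_orthonormal_basis[OF assms(16)] and pV = proj_mat_orthonormal_basis[OF assms(17)]
  have PQ: "P \<in> carrier_mat n n" "Q \<in> carrier_mat n n" "Q\<^sup>T = Q"
    by (auto simp: P_def Q_def pU pV transpose_mult_dim)
  have PQc: "proj_mat n (vec_compl n Us) = 1\<^sub>m n - P" "proj_mat n (vec_compl n Vs) = 1\<^sub>m n - Q"
    by (simp_all add: P_def Q_def pU pV)
  have LR: "L \<in> carrier_mat n n" "R \<in> carrier_mat n n" using PQ by (auto simp: L_def R_def)
  have tr_smult: "(c \<cdot>\<^sub>m A)\<^sup>T = c \<cdot>\<^sub>m A\<^sup>T" for c and A :: "real mat"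
    by (rule eq_matI) auto
  \<comment> \<open>Symmetry of \<open>R\<close> lets \<open>R\<^sup>T * V\<close> be evaluated by
    the same lemma as \<open>L * U\<close>.\<close>
  have Rt: "R\<^sup>T = R"
    unfolding R_def using PQ
    by (simp add: transpose_add[of _ n n] transpose_minus[of _ n n] tr_smult)
  have LU: "L * U = M * E * mat_diag r f"
    unfolding L_def P_def pU U E_def weighted_proj_orthogonal[OF rr w(1,2) BL, of \<theta>\<^sub>u]
    by (simp add: M_def f_def[abs_def] assms(22)[symmetric] mult_mat_assoc_dim)
  have RV: "R\<^sup>T * V = N * E * mat_diag r g"
    unfolding Rt unfolding R_def Q_def pV V E_def weighted_proj_orthogonal[OF rr w(2,3) BR, of \<theta>\<^sub>v]
    by (simp add: N_def g_def[abs_def] assms(23)[symmetric] mult_mat_assoc_dim)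
  have pos: "f i > 0" "g i > 0" for i
    using weighted_cos_sin_pos[OF w(1,2)] weighted_cos_sin_pos[OF w(2,3)]
    by (simp_all add: f_def g_def)
  have H: "H = (1 / w3) \<cdot>\<^sub>m (L * X * R)"
    unfolding H_def h_w_def PQc P_def[symmetric] Q_def[symmetric] L_def R_def
    by (rule h_w_factor) (use PQ assms(3,21) w in auto)
  have Hc: "H \<in> carrier_mat n n" unfolding H using LR assms(3) by auto
  \<comment> \<open>The explicit singular values are forgotten here, since sign and support depend
    on the bases alone.\<close>
  have "\<exists>S'. reduced_svd H r (M * E) S' (N * E)"
    using reduced_svd_sandwich[OF svd assms(3) LR ME LU RV pos, of "1 / w3"] w(2) H by auto
  then obtain S' where "reduced_svd H r (M * first_cols n r) S' (N * first_cols n r)"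
    by (auto simp: E_def)
  note main = sgn_supp_orthogonal[OF \<open>r \<le> n\<close> M N Hc this, folded assms(25)]
  have That: "That = supp n H" by (simp add: assms(24) H_def)
  have pc: "padded_id n r \<in> carrier_mat n n" using \<open>r \<le> n\<close> by (auto simp: padded_id_def)
  note car = frob_proj_supp_carrier[OF reduced_svd_padded_id[OF \<open>r \<le> n\<close>] pc, folded assms(25)]
  \<comment> \<open>Separating the factors of \<open>M\<close> and \<open>N\<close> requires the
    size of the projected matrix, which \<open>car\<close> supplies.\<close>
  have expand: "M * A * N\<^sup>T = B\<^sub>L * O\<^sub>L * A * O\<^sub>R\<^sup>T * B\<^sub>R\<^sup>T" if "A \<in> carrier_mat n n" for A
  proof -
    have "dim_row A = n" "dim_col A = n" using that by auto
    then show ?thesis by (simp add: M_def N_def transpose_mult_dim mult_mat_assoc_dim)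
  qed
  have inner: "M\<^sup>T * Z * N = O\<^sub>L\<^sup>T * B\<^sub>L\<^sup>T * Z * B\<^sub>R * O\<^sub>R" "M\<^sup>T * Z * N \<in> carrier_mat n n"
    if "Z \<in> carrier_mat n n" for Z
  proof -
    have "dim_row Z = n" "dim_col Z = n" using that by auto
    then show "M\<^sup>T * Z * N = O\<^sub>L\<^sup>T * B\<^sub>L\<^sup>T * Z * B\<^sub>R * O\<^sub>R"
      by (simp add: M_def N_def transpose_mult_dim mult_mat_assoc_dim)
    show "M\<^sup>T * Z * N \<in> carrier_mat n n" using M N that by auto
  qed
  show ?thesis
    unfolding H_def[symmetric] That
    using main car expand inner by (simp del: assoc_mult_mat)
qed

end
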